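(* For any set $X$, the group $G=S_\omega(X)$ is $\sigma$-discrete in the restricted Zariski topology $\mathfrak Z_G''$, and consequently $G$ is $\sigma$-discrete in each Hausdorff shift-invariant topology on $G$.
   Context: $S_\omega(X)$ is the group of all bijections $f:X\to X$ with finite support $\{x\in X:f(x)\ne x\}$, under composition. For a group $G$ with identity $1_G$, the restricted Zariski topology $\mathfrak Z_G''$ is generated by the sub-base consisting of the sets $\{x\in G: xbx^{-1}\ne aba^{-1}\}$, where $a,b\in G$ and $b^2=1_G$. A topology on a group $G$ is shift-invariant if for any $a,b\in G$ the two-sided shift $G\to G$, $x\mapsto axb$, is continuous. A topological space is $\sigma$-discrete if it can be written as a countable union of subspaces each of which is discrete in its subspace topology. *)

theory Defs
  imports
    "HOL-Algebra.Group"
    "HOL-Combinatorics.Permutations"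
    "HOL-Analysis.T1_Spaces"
begin

text \<open>
  A bijection of \<open>X\<close> onto itself is represented, as in \<^theory>\<open>HOL-Combinatorics.Permutations\<close>,
  by the total function that extends it by the identity outside \<open>X\<close>.
\<close>
definition finsupp_sym_group :: "'a set \<Rightarrow> ('a \<Rightarrow> 'a) monoid" where
  "finsupp_sym_group X =
     \<lparr>carrier = {f. f permutes X \<and> finite {x \<in> X. f x \<noteq> x}}, monoid.mult = (\<circ>), one = id\<rparr>"

text \<open>
  A sub-base need not cover the group: the empty intersection of sub-basic sets is the whole group.
  Since \<^const>\<open>topology_generated_by\<close> does not include the empty intersection, the carrier is
  added explicitly. This matters when \<open>G\<close> has no noncentral involutions; then all sub-basic sets
  are empty.
\<close>
definition restricted_zariski_topology :: "('g, 'm) monoid_scheme \<Rightarrow> 'g topology" where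
  "restricted_zariski_topology G =
     topology_generated_by (insert (carrier G)
       {{x \<in> carrier G. x \<otimes>\<^bsub>G\<^esub> b \<otimes>\<^bsub>G\<^esub> inv\<^bsub>G\<^esub> x \<noteq> a \<otimes>\<^bsub>G\<^esub> b \<otimes>\<^bsub>G\<^esub> inv\<^bsub>G\<^esub> a} | a b.
          a \<in> carrier G \<and> b \<in> carrier G \<and> b [^]\<^bsub>G\<^esub> (2::nat) = \<one>\<^bsub>G\<^esub>})"

definition shift_invariant_topology :: "('g, 'm) monoid_scheme \<Rightarrow> 'g topology \<Rightarrow> bool" where
  "shift_invariant_topology G T \<longleftrightarrow>
     topspace T = carrier G \<and>
     (\<forall>a\<in>carrier G. \<forall>b\<in>carrier G. continuous_map T T (\<lambda>x. a \<otimes>\<^bsub>G\<^esub> x \<otimes>\<^bsub>G\<^esub> b))"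

definition sigma_discrete_space :: "'g topology \<Rightarrow> bool" where
  "sigma_discrete_space T \<longleftrightarrow>
     (\<exists>\<A>. countable \<A> \<and> \<Union>\<A> = topspace T \<and>
        (\<forall>A\<in>\<A>. subtopology T A = discrete_topology A))"

lemma topspace_restricted_zariski_topology [simp]:
  "topspace (restricted_zariski_topology G) = carrier G"
  unfolding restricted_zariski_topology_def topology_generated_by_topspace by auto

lemma group_finsupp_sym_group: "group (finsupp_sym_group X)"
proof (rule groupI)
  fix f g assume f: "f \<in> carrier (finsupp_sym_group X)" and g: "g \<in> carrier (finsupp_sym_group X)"
  have "{x \<in> X. (f \<circ> g) x \<noteq> x} \<subseteq> {x \<in> X. f x \<noteq> x} \<union> {x \<in> X. g x \<noteq> x}"
    by auto
  then have "finite {x \<in> X. (f \<circ> g) x \<noteq> x}"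
    by (rule finite_subset) (use f g in \<open>auto simp: finsupp_sym_group_def\<close>)
  then show "f \<otimes>\<^bsub>finsupp_sym_group X\<^esub> g \<in> carrier (finsupp_sym_group X)"
    using f g by (auto simp: finsupp_sym_group_def permutes_compose)
next
  fix f assume f: "f \<in> carrier (finsupp_sym_group X)"
  then have p: "f permutes X" by (simp add: finsupp_sym_group_def)
  have "{x \<in> X. Hilbert_Choice.inv f x \<noteq> x} = {x \<in> X. f x \<noteq> x}"
    using permutes_inv_eq[OF p] by metis
  then have "Hilbert_Choice.inv f \<in> carrier (finsupp_sym_group X)"
    using f by (simp add: finsupp_sym_group_def permutes_inv)
  then show "\<exists>g\<in>carrier (finsupp_sym_group X).
      g \<otimes>\<^bsub>finsupp_sym_group X\<^esub> f = \<one>\<^bsub>finsupp_sym_group X\<^esub>"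
    using permutes_inv_o(2)[OF p] by (auto simp: finsupp_sym_group_def)
qed (auto simp: finsupp_sym_group_def comp_assoc)

end

theory Submission
  imports Defs "HOL-Analysis.Abstract_Topological_Spaces"
begin

text \<open>
  If \<open>X\<close> is finite, so is \<open>G\<close>. Otherwise let \<open>G\<^sub>n\<close> consist of the permutations whose support has
  \<open>n\<close> elements. Conjugating the transposition of \<open>x\<close> and \<open>y\<close> shows that the permutations that do not
  preserve \<open>{x, y}\<close> form an open set. Given \<open>f\<close> in \<open>G\<^sub>n\<close>, fix \<open>n + 1\<close> points \<open>y\<close> outside the support
  of \<open>f\<close>: one of them is fixed by any given \<open>g\<close> in \<open>G\<^sub>n\<close>, so if \<open>g\<close> preserves no pair \<open>{x, y}\<close> with
  \<open>x\<close> in the support of \<open>f\<close>, then \<open>g\<close> moves every such \<open>x\<close>, and \<open>g\<close> has the same support as \<open>f\<close>.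
  There are only finitely many such \<open>g\<close>, and the topology is T1, hence \<open>G\<^sub>n\<close> is discrete.

  For an involution \<open>b\<close> and \<open>c = a b a\<^sup>-\<^sup>1\<close>, the equation \<open>x b x\<^sup>-\<^sup>1 = c\<close> amounts to \<open>c x b = x\<close>, so it
  defines a closed set in every Hausdorff shift-invariant topology, which therefore refines the
  restricted Zariski topology.
\<close>

section \<open>Discrete subspaces and refinement of topologies\<close>

lemma subtopology_eq_discrete_topologyI:
  assumes "A \<subseteq> topspace T" and "\<And>x. x \<in> A \<Longrightarrow> \<exists>U. openin T U \<and> U \<inter> A = {x}"
  shows "subtopology T A = discrete_topology A"
proof -
  have "topspace (subtopology T A) = A"
    using assms(1) by auto
  moreover have "openin (subtopology T A) {x}" if "x \<in> A" for x
    using assms(2)[OF that] unfolding openin_subtopology by metis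
  ultimately have "discrete_topology A = subtopology T A"
    unfolding discrete_topology_unique by blast
  then show ?thesis ..
qed

lemma sigma_discrete_space_countable:
  assumes "countable (topspace T)"
  shows "sigma_discrete_space T"
  unfolding sigma_discrete_space_def
proof (intro exI conjI ballI)
  show "countable ((\<lambda>x. {x}) ` topspace T)"
    using assms by simp
  fix A assume "A \<in> (\<lambda>x. {x}) ` topspace T"
  then show "subtopology T A = discrete_topology A"
    by (intro subtopology_eq_discrete_topologyI) (auto intro!: exI[of _ "topspace T"])
qed auto

text \<open>Singletons that are relatively open for \<open>S\<close> stay relatively open for the
  finer \<open>T\<close>, so the same countable cover serves.\<close>

lemma sigma_discrete_space_finer:
  assumes "sigma_discrete_space S" and "topspace T = topspace S"
    and finer: "\<And>U. openin S U \<Longrightarrow> openin T U"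
  shows "sigma_discrete_space T"
proof -
  have "subtopology T A = discrete_topology A" if A: "subtopology S A = discrete_topology A" for A
  proof (rule subtopology_eq_discrete_topologyI)
    show "A \<subseteq> topspace T"
      using A assms(2) by (metis inf.absorb_iff2 inf_le1 topspace_discrete_topology topspace_subtopology)
    show "\<exists>U. openin T U \<and> U \<inter> A = {x}" if "x \<in> A" for x
    proof -
      have "openin (subtopology S A) {x}"
        using A that by simp
      then show ?thesis
        unfolding openin_subtopology using finer by metis
    qed
  qed
  then show ?thesis
    using assms(1,2) unfolding sigma_discrete_space_def by metis
qed

section \<open>Comparison with Hausdorff shift-invariant topologies\<close>

lemma (in group) openin_shift_invariant_if_openin_restricted_zariski:
  assumes T: "Hausdorff_space T" "shift_invariant_topology G T"
    and U: "openin (restricted_zariski_topology G) U"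
  shows "openin T U"
proof -
  have top: "topspace T = carrier G"
    using T(2) by (simp add: shift_invariant_topology_def)
  have "openin T {x \<in> carrier G. x \<otimes> b \<otimes> inv x \<noteq> a \<otimes> b \<otimes> inv a}"
    if a: "a \<in> carrier G" and b: "b \<in> carrier G" "b [^] (2::nat) = \<one>" for a b
  proof -
    define c where "c = a \<otimes> b \<otimes> inv a"
    have c: "c \<in> carrier G"
      using a b by (simp add: c_def)
    have bb: "b \<otimes> b = \<one>"
      using b by (simp add: numeral_2_eq_2)
    have "x \<otimes> b \<otimes> inv x = c \<longleftrightarrow> c \<otimes> x \<otimes> b = x" if x: "x \<in> carrier G" for x
    proof -
      have "x \<otimes> b \<otimes> inv x = c \<longleftrightarrow> x \<otimes> b = c \<otimes> x"
        using x b c by (metis inv_closed inv_solve_right m_closed)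
      also have "\<dots> \<longleftrightarrow> x \<otimes> b \<otimes> b = c \<otimes> x \<otimes> b"
        using x b c by simp
      also have "x \<otimes> b \<otimes> b = x"
        using x b bb by (simp add: m_assoc)
      finally show ?thesis by auto
    qed
    then have "{x \<in> carrier G. x \<otimes> b \<otimes> inv x \<noteq> c}
        = topspace T - {x \<in> topspace T. c \<otimes> x \<otimes> b = x}"
      by (auto simp: top)
    \<comment> \<open>This set is the equalizer of a two-sided shift and the identity, two
      continuous maps into a Hausdorff space.\<close>
    moreover have "closedin T {x \<in> topspace T. c \<otimes> x \<otimes> b = x}"
      using T b c
      by (intro closedin_continuous_maps_eq[of T]) (auto simp: shift_invariant_topology_def)
    ultimately show ?thesis
      by (simp add: c_def openin_diff)
  qed
  moreover have "openin T (carrier G)"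
    by (metis top openin_topspace)
  ultimately have "openin T V" if "V \<in> insert (carrier G)
       {{x \<in> carrier G. x \<otimes> b \<otimes> inv x \<noteq> a \<otimes> b \<otimes> inv a} | a b.
          a \<in> carrier G \<and> b \<in> carrier G \<and> b [^] (2::nat) = \<one>}" for V
    using that by auto
  moreover have "generate_topology_on (insert (carrier G)
       {{x \<in> carrier G. x \<otimes> b \<otimes> inv x \<noteq> a \<otimes> b \<otimes> inv a} | a b.
          a \<in> carrier G \<and> b \<in> carrier G \<and> b [^] (2::nat) = \<one>}) U"
    using U unfolding restricted_zariski_topology_def openin_topology_generated_by_iff .
  ultimately show ?thesis
    by (rule generate_topology_on_coarsest[OF istopology_openin])
qed

section \<open>Conjugates of transpositions\<close>

lemma inv_finsupp_sym_group:
  assumes f: "f \<in> carrier (finsupp_sym_group X)"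
  shows "inv\<^bsub>finsupp_sym_group X\<^esub> f = Hilbert_Choice.inv f"
proof -
  interpret group "finsupp_sym_group X" by (rule group_finsupp_sym_group)
  have "f permutes X"
    using f by (simp add: finsupp_sym_group_def)
  moreover have "f \<circ> inv\<^bsub>finsupp_sym_group X\<^esub> f = id"
    using r_inv[OF f] by (simp add: finsupp_sym_group_def)
  ultimately show ?thesis
    by (metis bij_is_inj comp_assoc comp_id id_comp inv_o_cancel permutes_bij)
qed

text \<open>A nontrivial transposition determines the pair that it swaps. The case
  \<open>x = y\<close> is excluded because \<open>transpose u u\<close> is the identity for every
  \<open>u\<close>.\<close>

lemma transpose_eq_transpose_iff:
  assumes "x \<noteq> y"
  shows "Transposition.transpose x y = Transposition.transpose u v \<longleftrightarrow> {x, y} = {u, v}"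
proof
  assume eq: "Transposition.transpose x y = Transposition.transpose u v"
  have "Transposition.transpose u v x = y" "Transposition.transpose u v y = x"
    using eq by (metis transpose_apply_first, metis transpose_apply_second)
  then show "{x, y} = {u, v}"
    using assms by (auto simp: Transposition.transpose_def split: if_splits)
next
  assume "{x, y} = {u, v}"
  then show "Transposition.transpose x y = Transposition.transpose u v"
    by (auto simp: doubleton_eq_iff transpose_commute)
qed

text \<open>This is the sub-basic set for the transposition \<open>b\<close> of \<open>x\<close> and
  \<open>y\<close>: its conjugate by \<open>f\<close> swaps \<open>f x\<close> and
  \<open>f y\<close>, and so encodes the image of the pair.\<close>

lemma openin_restricted_zariski_image_pair_neq:
  assumes "x \<in> X" "y \<in> X" "x \<noteq> y" and a: "a \<in> carrier (finsupp_sym_group X)"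
  shows "openin (restricted_zariski_topology (finsupp_sym_group X))
           {f \<in> carrier (finsupp_sym_group X). f ` {x, y} \<noteq> a ` {x, y}}"
proof -
  let ?G = "finsupp_sym_group X"
  let ?b = "Transposition.transpose x y"
  have bij: "bij f" if "f \<in> carrier ?G" for f
    using that by (auto simp: finsupp_sym_group_def permutes_bij)
  have conj: "f \<otimes>\<^bsub>?G\<^esub> ?b \<otimes>\<^bsub>?G\<^esub> inv\<^bsub>?G\<^esub> f = Transposition.transpose (f x) (f y)" if "f \<in> carrier ?G" for f
  proof -
    have "f \<circ> ?b \<circ> Hilbert_Choice.inv f = Transposition.transpose (f x) (f y)"
      \<comment> \<open>This instance gives
        \<open>transpose (f x) (f y) \<circ> f = f \<circ> ?b\<close>; it remains to cancel
        \<open>f\<close> on the right.\<close>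
      using bij[OF that] transpose_comp_eq[OF bij[OF that], of "f x" "f y"]
      by (metis bij_is_inj bij_is_surj comp_assoc comp_id inv_f_f surj_iff)
    then show ?thesis
      using inv_finsupp_sym_group[OF that] by (simp add: finsupp_sym_group_def)
  qed
  have b: "?b \<in> carrier ?G"
  proof -
    have "finite {z \<in> X. ?b z \<noteq> z}"
      by (rule finite_subset[of _ "{x, y}"]) (auto simp: Transposition.transpose_def)
    then show ?thesis
      using assms by (auto simp: finsupp_sym_group_def intro: permutes_swap_id)
  qed
  interpret group ?G by (rule group_finsupp_sym_group)
  have "?b [^]\<^bsub>?G\<^esub> (2::nat) = \<one>\<^bsub>?G\<^esub>"
    using b by (simp add: numeral_2_eq_2) (simp add: finsupp_sym_group_def)
  moreover have "f ` {x, y} \<noteq> a ` {x, y} \<longleftrightarrow>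
      f \<otimes>\<^bsub>?G\<^esub> ?b \<otimes>\<^bsub>?G\<^esub> inv\<^bsub>?G\<^esub> f \<noteq> a \<otimes>\<^bsub>?G\<^esub> ?b \<otimes>\<^bsub>?G\<^esub> inv\<^bsub>?G\<^esub> a" if "f \<in> carrier ?G" for f
  proof -
    have "f x \<noteq> f y"
      using bij[OF that] assms(3) by (metis bij_is_inj inj_eq)
    then show ?thesis
      using conj[OF that] conj[OF a] by (simp add: transpose_eq_transpose_iff)
  qed
  then have "{f \<in> carrier ?G. f ` {x, y} \<noteq> a ` {x, y}} =
      {f \<in> carrier ?G. f \<otimes>\<^bsub>?G\<^esub> ?b \<otimes>\<^bsub>?G\<^esub> inv\<^bsub>?G\<^esub> f \<noteq> a \<otimes>\<^bsub>?G\<^esub> ?b \<otimes>\<^bsub>?G\<^esub> inv\<^bsub>?G\<^esub> a}"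
    by blast
  ultimately show ?thesis
    unfolding restricted_zariski_topology_def using a b
    by (intro topology_generated_by_Basis) auto
qed

text \<open>The size of \<open>X\<close> matters: with two points the group is abelian, every
  sub-basic set other than the carrier is empty, and the topology is not T1.\<close>

lemma t1_space_restricted_zariski_finsupp_sym_group:
  assumes "infinite X"
  shows "t1_space (restricted_zariski_topology (finsupp_sym_group X))"
  unfolding t1_space_def topspace_restricted_zariski_topology
proof (intro ballI impI)
  fix f g assume f: "f \<in> carrier (finsupp_sym_group X)" and g: "g \<in> carrier (finsupp_sym_group X)"
    and "f \<noteq> g"
  have p: "f permutes X" "g permutes X"
    using f g by (auto simp: finsupp_sym_group_def)
  obtain x where x: "f x \<noteq> g x"
    using \<open>f \<noteq> g\<close> by blast
  then have "x \<in> X"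
    using p by (metis permutes_not_in)
  \<comment> \<open>Differing at \<open>x\<close> is not enough, since \<open>f\<close> and
    \<open>g\<close> may exchange the images of a pair. Avoiding the \<open>g\<close>-preimage of
    \<open>f x\<close> keeps \<open>f x\<close> out of the image of \<open>{x, y}\<close> under
    \<open>g\<close>.\<close>
  have "X - {x, Hilbert_Choice.inv g (f x)} \<noteq> {}"
    using assms by (intro infinite_imp_nonempty) simp
  then obtain y where y: "y \<in> X" "y \<noteq> x" "y \<noteq> Hilbert_Choice.inv g (f x)"
    by blast
  have "f x \<noteq> g y"
    using y(3) p(2) by (metis permutes_inverses(2))
  then have "f ` {x, y} \<noteq> g ` {x, y}"
    using x by auto
  then show "\<exists>U. openin (restricted_zariski_topology (finsupp_sym_group X)) U \<and> f \<in> U \<and> g \<notin> U"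
    using openin_restricted_zariski_image_pair_neq[OF \<open>x \<in> X\<close> y(1) y(2)[symmetric] g] f by blast
qed

lemma sigma_discrete_restricted_zariski_finsupp_sym_group:
  fixes X :: "'a set"
  shows "sigma_discrete_space (restricted_zariski_topology (finsupp_sym_group X))"
proof (cases "finite X")
  case True
  \<comment> \<open>Here T1 may fail, but a countable space is covered by its singletons.\<close>
  have "finite (carrier (finsupp_sym_group X))"
    by (rule finite_subset[OF _ finite_permutations[OF True]]) (auto simp: finsupp_sym_group_def)
  then show ?thesis
    by (intro sigma_discrete_space_countable) (simp add: countable_finite)
next
  case False
  let ?G = "finsupp_sym_group X"
  let ?Z = "restricted_zariski_topology ?G"
  define supp where "supp f = {x \<in> X. f x \<noteq> x}" for f :: "'a \<Rightarrow> 'a"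
  have carrier: "f permutes X" "finite (supp f)" if "f \<in> carrier ?G" for f
    using that by (auto simp: finsupp_sym_group_def supp_def)
  have id: "id \<in> carrier ?G"
    by (simp add: finsupp_sym_group_def permutes_id)
  have t1: "t1_space ?Z"
    using False by (rule t1_space_restricted_zariski_finsupp_sym_group)
  define A where "A n = {f \<in> carrier ?G. card (supp f) = n}" for n
  have "subtopology ?Z (A n) = discrete_topology (A n)" for n
  proof (rule subtopology_eq_discrete_topologyI)
    show "A n \<subseteq> topspace ?Z"
      by (auto simp: A_def)
    fix f assume f: "f \<in> A n"
    then have fG: "f \<in> carrier ?G" and n: "card (supp f) = n"
      by (auto simp: A_def)
    have "infinite (X - supp f)"
      using False carrier(2)[OF fG] by simp
    then obtain Y where Y: "finite Y" "card Y = Suc n" "Y \<subseteq> X - supp f"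
      using infinite_arbitrarily_large by blast
    \<comment> \<open>Intersecting with \<open>topspace ?Z\<close> matters for
      \<open>f = id\<close>: then the index set is empty and the inner intersection is
      \<open>UNIV\<close>.\<close>
    define V where "V = topspace ?Z \<inter>
      (\<Inter>(x, y)\<in>supp f \<times> Y. {g \<in> carrier ?G. g ` {x, y} \<noteq> id ` {x, y}})"
    have "openin ?Z V"
      unfolding V_def
      using openin_restricted_zariski_image_pair_neq[OF _ _ _ id] Y carrier(2)[OF fG]
      by (intro openin_Int_Inter openin_topspace) (auto simp: supp_def)
    have "f \<in> V"
    proof -
      have "f ` {x, y} \<noteq> {x, y}" if "x \<in> supp f" "y \<in> Y" for x y
      proof -
        \<comment> \<open>Since \<open>f\<close> fixes \<open>y\<close>, preserving the pair would
          force it to fix \<open>x\<close> too.\<close>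
        have "f x \<noteq> x" "f y = y" "x \<noteq> y"
          using that Y by (auto simp: supp_def)
        moreover have "f x \<noteq> f y"
          using \<open>x \<noteq> y\<close> carrier(1)[OF fG] by (metis permutes_inj inj_eq)
        ultimately show ?thesis by auto
      qed
      then show ?thesis
        using fG by (auto simp: V_def)
    qed
    have "g permutes supp f" if gV: "g \<in> V" and gA: "g \<in> A n" for g
    proof -
      have gG: "g \<in> carrier ?G" and gn: "card (supp g) = n"
        using gA by (auto simp: A_def)
      obtain y where y: "y \<in> Y" "y \<notin> supp g"
        using Y(2) gn carrier(2)[OF gG] by (metis card_mono not_less_eq_eq order_refl subsetI)
      then have "g y = y"
        using Y(3) by (auto simp: supp_def)
      have "supp f \<subseteq> supp g"
      proof
        fix x assume x: "x \<in> supp f"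
        have "g ` {x, y} \<noteq> {x, y}"
          using gV x y(1) by (auto simp: V_def)
        then show "x \<in> supp g"
          using \<open>g y = y\<close> x by (auto simp: supp_def)
      qed
      then have "supp g = supp f"
        using n gn carrier(2)[OF gG] by (metis card_subset_eq)
      then show ?thesis
        using carrier(1)[OF gG] by (auto intro: permutes_superset simp: supp_def)
    qed
    \<comment> \<open>T1 makes finite sets closed, so the points of \<open>V \<inter> A n\<close>
      other than \<open>f\<close> can be removed from \<open>V\<close>.\<close>
    then have "finite (V \<inter> A n)"
      by (intro finite_subset[OF _ finite_permutations[OF carrier(2)[OF fG]]]) auto
    then have "closedin ?Z (V \<inter> A n - {f})"
      using t1 by (auto simp: t1_space_closedin_finite A_def)
    then have "openin ?Z (V - (V \<inter> A n - {f}))"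
      using \<open>openin ?Z V\<close> by (rule openin_diff[rotated])
    moreover have "(V - (V \<inter> A n - {f})) \<inter> A n = {f}"
      using \<open>f \<in> V\<close> f by auto
    ultimately show "\<exists>U. openin ?Z U \<and> U \<inter> A n = {f}"
      by blast
  qed
  moreover have "(\<Union>n. A n) = topspace ?Z"
    by (auto simp: A_def)
  ultimately show ?thesis
    unfolding sigma_discrete_space_def by (intro exI[of _ "range A"]) auto
qed

theorem corollary6p3:
  fixes X :: "'a set"
  shows "sigma_discrete_space (restricted_zariski_topology (finsupp_sym_group X)) \<and>
    (\<forall>T. Hausdorff_space T \<and> shift_invariant_topology (finsupp_sym_group X) T
       \<longrightarrow> sigma_discrete_space T)"
proof (intro conjI allI impI, goal_cases)
  case 1
  show ?case by (rule sigma_discrete_restricted_zariski_finsupp_sym_group)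
next
  case (2 T)
  then have "topspace T = topspace (restricted_zariski_topology (finsupp_sym_group X))"
    by (simp add: shift_invariant_topology_def)
  with 2 show ?case
    using group.openin_shift_invariant_if_openin_restricted_zariski[OF group_finsupp_sym_group]
    by (metis sigma_discrete_space_finer sigma_discrete_restricted_zariski_finsupp_sym_group)
qed

end
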